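(* Let $\{X_n\}_{n=0}^\infty$ be a random walk in the deterministic "have your cookie and eat it" environment with $\omega(x)=p$ for all $x\in\mathbb{Z}$. Then $$P_1(T_0=\infty)\ge\frac{3p-2}{2p-1}\quad\text{for } p\in(\tfrac23,\tfrac34),$$ $$P_1(T_0=\infty)=\frac{3p-2}{2p-1}\quad\text{for } p\in[\tfrac34,1).$$
   Context: Random walk in a "have your cookie and eat it" environment: given $\omega=\{\omega(x)\}_{x\in\mathbb{Z}}$ with $\omega(x)\in[\frac12,1)$, the process $\{X_n\}_{n\ge0}$ is the nearest-neighbor process on $\mathbb{Z}$ (each step is $\pm1$) such that, conditionally on $X_0,\dots,X_n$, the probability that $X_{n+1}=X_n+1$ equals $\omega(X_n)$ if the process has not previously jumped left from the site $X_n$ (i.e. there is no $k<n$ with $X_k=X_n$ and $X_{k+1}=X_n-1$), and equals $\frac12$ otherwise; with the complementary probability $X_{n+1}=X_n-1$. $P_x$ denotes the law of the process started from $X_0=x$ (with no cookie consumed at time $0$). $T_x=\inf\{n\ge0:X_n=x\}$ (with $\inf\emptyset=\infty$). *)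

theory Defs
  imports "HOL-Probability.Probability" "HOL-Library.Extended_Nat"
begin

definition jumped_left_before :: "(nat \<Rightarrow> int) \<Rightarrow> nat \<Rightarrow> bool" where
  "jumped_left_before s n \<longleftrightarrow> (\<exists>k<n. s k = s n \<and> s (Suc k) = s n - 1)"

definition right_prob :: "(int \<Rightarrow> real) \<Rightarrow> (nat \<Rightarrow> int) \<Rightarrow> nat \<Rightarrow> real" where
  "right_prob \<omega> s n = (if jumped_left_before s n then 1 / 2 else \<omega> (s n))"

text \<open>
  A process with law \<open>P\<^sub>x\<close> in the environment \<open>\<omega>\<close>, on an arbitrary probability space.
  Since the process takes values in a countable set, conditioning on \<open>X 0, \<dots>, X n\<close> is
  elementary conditioning on each possible trajectory \<open>s\<close> up to time \<open>n\<close>. Only the values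
  of \<open>s\<close> on \<open>{..n}\<close> matter.
\<close>

locale cookie_walk = prob_space M
  for M :: "'a measure" and \<omega> :: "int \<Rightarrow> real" and x :: int and X :: "nat \<Rightarrow> 'a \<Rightarrow> int" +
  assumes environment: "\<And>y. \<omega> y \<in> {1 / 2..<1}"
    and X_measurable [measurable]: "\<And>n. X n \<in> M \<rightarrow>\<^sub>M count_space UNIV"
    and X_0: "AE w in M. X 0 w = x"
    and step_right: "\<And>n s. prob {w \<in> space M. \<forall>k\<le>n. X k w = s k} > 0 \<Longrightarrow>
      \<P>(w in M. X (Suc n) w = X n w + 1 \<bar> \<forall>k\<le>n. X k w = s k) = right_prob \<omega> s n"
    and step_left: "\<And>n s. prob {w \<in> space M. \<forall>k\<le>n. X k w = s k} > 0 \<Longrightarrow>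
      \<P>(w in M. X (Suc n) w = X n w - 1 \<bar> \<forall>k\<le>n. X k w = s k) = 1 - right_prob \<omega> s n"

text \<open>The infimum of the empty set in \<^typ>\<open>enat\<close> is \<open>\<infinity>\<close>.\<close>

definition hitting_time :: "(nat \<Rightarrow> 'a \<Rightarrow> int) \<Rightarrow> int \<Rightarrow> 'a \<Rightarrow> enat" where
  "hitting_time X y w = (INF n\<in>{n. X n w = y}. enat n)"

text \<open>
  For every environment and starting point such a process exists: it can be driven by
  independent uniform variables \<open>u n\<close>, stepping right at time \<open>n\<close> iff \<open>u n\<close> is below the
  current probability of a right step.
\<close>

lemma right_prob_cong:
  assumes "\<And>k. k \<le> n \<Longrightarrow> s k = s' k"
  shows "right_prob \<omega> s n = right_prob \<omega> s' n"
  using assms unfolding right_prob_def jumped_left_before_def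
  by (smt (verit) Suc_leI le_refl less_imp_le)

fun coin_path :: "(int \<Rightarrow> real) \<Rightarrow> int \<Rightarrow> (nat \<Rightarrow> real) \<Rightarrow> nat \<Rightarrow> int list" where
  "coin_path \<omega> x u 0 = [x]"
| "coin_path \<omega> x u (Suc n) = coin_path \<omega> x u n @
     [coin_path \<omega> x u n ! n + (if u n < right_prob \<omega> ((!) (coin_path \<omega> x u n)) n then 1 else - 1)]"

definition coin_walk :: "(int \<Rightarrow> real) \<Rightarrow> int \<Rightarrow> nat \<Rightarrow> (nat \<Rightarrow> real) \<Rightarrow> int" where
  "coin_walk \<omega> x n u = coin_path \<omega> x u n ! n"

lemma length_coin_path [simp]: "length (coin_path \<omega> x u n) = Suc n"
  by (induction n) auto

lemma coin_path_nth: "k \<le> n \<Longrightarrow> coin_path \<omega> x u n ! k = coin_walk \<omega> x k u"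
  by (induction n) (auto simp: coin_walk_def nth_append le_Suc_eq)

lemma coin_walk_0 [simp]: "coin_walk \<omega> x 0 u = x"
  by (simp add: coin_walk_def)

lemma coin_walk_Suc:
  "coin_walk \<omega> x (Suc n) u =
     coin_walk \<omega> x n u + (if u n < right_prob \<omega> (\<lambda>k. coin_walk \<omega> x k u) n then 1 else - 1)"
proof -
  have "right_prob \<omega> ((!) (coin_path \<omega> x u n)) n = right_prob \<omega> (\<lambda>k. coin_walk \<omega> x k u) n"
    by (rule right_prob_cong) (simp add: coin_path_nth)
  thus ?thesis by (simp add: coin_walk_def nth_append)
qed

definition uniform_coins :: "(nat \<Rightarrow> real) measure" where
  "uniform_coins = PiM UNIV (\<lambda>_. uniform_measure lborel {0..1})"

lemma prob_space_uniform_01: "prob_space (uniform_measure lborel {0..1::real})"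
  by (rule prob_space_uniform_measure) auto

lemma measurable_coin_walk: "coin_walk \<omega> x n \<in> uniform_coins \<rightarrow>\<^sub>M count_space UNIV"
proof -
  have [measurable]: "(\<lambda>u. u k) \<in> borel_measurable uniform_coins" for k
    unfolding uniform_coins_def using measurable_component_singleton[of k UNIV "\<lambda>_. uniform_measure lborel {0..1::real}"]
    by (simp cong: measurable_cong_sets)
  have "(\<lambda>u. coin_path \<omega> x u n) \<in> uniform_coins \<rightarrow>\<^sub>M count_space UNIV"
  proof (induction n)
    case (Suc n)
    note [measurable] = Suc
    have "(\<lambda>u. (\<lambda>h u. h @ [h ! n + (if u n < right_prob \<omega> ((!) h) n then 1 else - 1)])
            (coin_path \<omega> x u n) u) \<in> uniform_coins \<rightarrow>\<^sub>M count_space UNIV"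
      by (rule measurable_compose_countable) measurable
    thus ?case by simp
  qed simp
  from measurable_compose[OF this, of "\<lambda>h. h ! n" "count_space UNIV"]
  show ?thesis by (simp add: coin_walk_def[abs_def])
qed

lemma measure_uniform_01:
  assumes "0 \<le> q" "q \<le> 1"
  shows "measure (uniform_measure lborel {0..1::real}) {..<q} = q"
    and "measure (uniform_measure lborel {0..1::real}) {q..} = 1 - q"
proof -
  have 1: "{0..1} \<inter> {..<q} = {0..<q}" "{0..1} \<inter> {q..} = {q..1}" using assms by auto
  show "measure (uniform_measure lborel {0..1::real}) {..<q} = q"
    and "measure (uniform_measure lborel {0..1::real}) {q..} = 1 - q"
    using assms by (subst measure_uniform_measure; simp add: 1)+
qed

lemma prob_uniform_coins_cylinder:
  assumes "\<And>k. A k \<in> sets borel"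
  shows "measure uniform_coins {u \<in> space uniform_coins. \<forall>k<n. u k \<in> A k} =
    (\<Prod>k<n. measure (uniform_measure lborel {0..1::real}) (A k))"
proof -
  interpret U: prob_space "uniform_measure lborel {0..1::real}" by (rule prob_space_uniform_01)
  interpret product_prob_space "\<lambda>_. uniform_measure lborel {0..1::real}" "UNIV :: nat set"
    by unfold_locales
  have "emeasure uniform_coins {u \<in> space uniform_coins. \<forall>k\<in>{..<n}. u k \<in> A k} =
    (\<Prod>k<n. emeasure (uniform_measure lborel {0..1::real}) (A k))"
    unfolding uniform_coins_def by (rule emeasure_PiM_Collect) (use assms in auto)
  hence "measure uniform_coins {u \<in> space uniform_coins. \<forall>k\<in>{..<n}. u k \<in> A k} =
    enn2real (\<Prod>k<n. ennreal (measure (uniform_measure lborel {0..1::real}) (A k)))"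
    by (simp only: measure_def[of uniform_coins] U.emeasure_eq_measure)
  thus ?thesis
    by (simp add: Ball_def prod_ennreal prod_nonneg del: measure_uniform_measure)
qed

lemma coin_walk_trajectory_iff:
  "(\<forall>k\<le>n. coin_walk \<omega> x k u = s k) \<longleftrightarrow>
   s 0 = x \<and> (\<forall>k<n. s (Suc k) = s k + 1 \<or> s (Suc k) = s k - 1) \<and>
   (\<forall>k<n. u k \<in> (if s (Suc k) = s k + 1 then {..<right_prob \<omega> s k} else {right_prob \<omega> s k..}))"
proof (induction n)
  case (Suc n)
  have *: "(\<forall>k\<le>Suc n. P k) \<longleftrightarrow> (\<forall>k\<le>n. P k) \<and> P (Suc n)" for P by (auto simp: le_Suc_eq)
  have **: "(\<forall>k<Suc n. P k) \<longleftrightarrow> (\<forall>k<n. P k) \<and> P n" for P by (auto simp: less_Suc_eq)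
  have "(\<forall>k\<le>n. coin_walk \<omega> x k u = s k) \<Longrightarrow> right_prob \<omega> (\<lambda>k. coin_walk \<omega> x k u) n = right_prob \<omega> s n"
    by (rule right_prob_cong) auto
  hence "(\<forall>k\<le>Suc n. coin_walk \<omega> x k u = s k) \<longleftrightarrow> (\<forall>k\<le>n. coin_walk \<omega> x k u = s k) \<and>
     s (Suc n) = s n + (if u n < right_prob \<omega> s n then 1 else - 1)"
    unfolding * coin_walk_Suc by auto
  also have "\<dots> \<longleftrightarrow> (s 0 = x \<and> (\<forall>k<Suc n. s (Suc k) = s k + 1 \<or> s (Suc k) = s k - 1) \<and>
   (\<forall>k<Suc n. u k \<in> (if s (Suc k) = s k + 1 then {..<right_prob \<omega> s k} else {right_prob \<omega> s k..})))"
    unfolding Suc.IH ** by (cases "u n < right_prob \<omega> s n") auto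
  finally show ?case .
qed auto

theorem cookie_walk_exists:
  assumes "\<And>y. \<omega> y \<in> {1 / 2..<1}"
  shows "cookie_walk uniform_coins \<omega> x (coin_walk \<omega> x)"
proof -
  let ?f = "\<lambda>s k. if s (Suc k) = s k + 1 then right_prob \<omega> s k else 1 - right_prob \<omega> s k"
  have q: "0 \<le> right_prob \<omega> s k" "right_prob \<omega> s k \<le> 1" for s k
    using assms[of "s k"] by (auto simp: right_prob_def)
  interpret prob_space uniform_coins
    unfolding uniform_coins_def by (rule prob_space_PiM) (rule prob_space_uniform_01)
  have path: "prob {u \<in> space uniform_coins. \<forall>k\<le>n. coin_walk \<omega> x k u = s k} =
     (if s 0 = x \<and> (\<forall>k<n. s (Suc k) = s k + 1 \<or> s (Suc k) = s k - 1) then \<Prod>k<n. ?f s k else 0)"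
    for s n
  proof (cases "s 0 = x \<and> (\<forall>k<n. s (Suc k) = s k + 1 \<or> s (Suc k) = s k - 1)")
    case True
    have "prob {u \<in> space uniform_coins. \<forall>k\<le>n. coin_walk \<omega> x k u = s k} = (\<Prod>k<n. measure (uniform_measure lborel {0..1::real})
        (if s (Suc k) = s k + 1 then {..<right_prob \<omega> s k} else {right_prob \<omega> s k..}))"
      unfolding coin_walk_trajectory_iff using True by (subst prob_uniform_coins_cylinder[symmetric]) auto
    also have "\<dots> = (\<Prod>k<n. ?f s k)"
      by (intro prod.cong refl)
        (simp only: if_distrib[of "measure _"] measure_uniform_01[OF q])
    finally show ?thesis using True by simp
  next
    case False
    hence "{u \<in> space uniform_coins. \<forall>k\<le>n. coin_walk \<omega> x k u = s k} = {}"
      unfolding coin_walk_trajectory_iff by blast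
    with False show ?thesis by (simp only: if_False measure_empty)
  qed
  have step: "\<P>(w in uniform_coins. coin_walk \<omega> x (Suc n) w = coin_walk \<omega> x n w + d \<bar> \<forall>k\<le>n. coin_walk \<omega> x k w = s k) =
        (if d = 1 then right_prob \<omega> s n else 1 - right_prob \<omega> s n)"
    if pos: "prob {w \<in> space uniform_coins. \<forall>k\<le>n. coin_walk \<omega> x k w = s k} > 0" and d: "d = 1 \<or> d = - 1" for n s d
  proof -
    let ?s = "s(Suc n := s n + d)"
    have rp: "right_prob \<omega> ?s k = right_prob \<omega> s k" if "k \<le> n" for k
      by (rule right_prob_cong) (use that in auto)
    have ev: "{w \<in> space uniform_coins. coin_walk \<omega> x (Suc n) w = coin_walk \<omega> x n w + d \<and> (\<forall>k\<le>n. coin_walk \<omega> x k w = s k)}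
      = {w \<in> space uniform_coins. \<forall>k\<le>Suc n. coin_walk \<omega> x k w = ?s k}"
      by (auto simp: le_Suc_eq)
    have C: "s 0 = x \<and> (\<forall>k<n. s (Suc k) = s k + 1 \<or> s (Suc k) = s k - 1)"
    proof (rule ccontr)
      assume "\<not> ?thesis"
      with pos show False unfolding path by (simp only: if_False less_irrefl)
    qed
    hence C': "?s 0 = x \<and> (\<forall>k<Suc n. ?s (Suc k) = ?s k + 1 \<or> ?s (Suc k) = ?s k - 1)"
      using d by (auto simp: less_Suc_eq)
    have "(\<Prod>k<n. ?f ?s k) = (\<Prod>k<n. ?f s k)"
      by (intro prod.cong refl) (simp add: rp)
    moreover have "?f ?s n = (if d = 1 then right_prob \<omega> s n else 1 - right_prob \<omega> s n)"
      unfolding rp[OF le_refl] by simp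
    ultimately have "(\<Prod>k<Suc n. ?f ?s k) =
        (\<Prod>k<n. ?f s k) * (if d = 1 then right_prob \<omega> s n else 1 - right_prob \<omega> s n)"
      by (simp only: prod.lessThan_Suc)
    hence eq: "prob {w \<in> space uniform_coins. \<forall>k\<le>Suc n. coin_walk \<omega> x k w = ?s k} =
        prob {w \<in> space uniform_coins. \<forall>k\<le>n. coin_walk \<omega> x k w = s k} *
        (if d = 1 then right_prob \<omega> s n else 1 - right_prob \<omega> s n)"
      unfolding path[of "Suc n" ?s] path[of n s] if_P[OF C] if_P[OF C'] .
    show ?thesis
      unfolding cond_prob_def ev eq
      by (rule nonzero_mult_div_cancel_left) (use pos in linarith)
  qed
  show ?thesis
  proof (intro cookie_walk.intro cookie_walk_axioms.intro)
    show "prob_space uniform_coins" by unfold_locales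
    show "\<omega> y \<in> {1 / 2..<1}" for y by (rule assms)
    show "coin_walk \<omega> x n \<in> uniform_coins \<rightarrow>\<^sub>M count_space UNIV" for n by (rule measurable_coin_walk)
    show "AE w in uniform_coins. coin_walk \<omega> x 0 w = x" by simp
  qed (use step[of _ _ 1] step[of _ _ "- 1"] in simp_all)
qed

end

theory Submission
  imports Defs
begin

text \<open>
  Put \<open>a = p / (1 - p)\<close>, so that \<open>a > 2\<close> iff \<open>p > 2/3\<close>. For every level \<open>N\<close>, the process
  \<open>(N - X n) / N\<close> times the product of \<open>(N - y + 1) / (N - y + a)\<close> over the sites \<open>y\<close> in \<open>{1..<N}\<close>
  whose cookie is still there is a bounded martingale up to the exit from \<open>{0<..<N}\<close>, and it vanishes at
  \<open>N\<close>. When the walk exits at \<open>0\<close> after reaching the maximum \<open>m < N\<close>, exactly the cookies above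
  \<open>m\<close> are left, so the final value depends on \<open>N - m\<close> only, and its sum over all \<open>N\<close> is the
  constant \<open>a / (a - 2)\<close>. Summing the optional stopping identity over \<open>N\<close> gives
  \<open>a / (a - 2) * P(T\<^sub>0 < \<infinity>) = a / (a - 2) - a / (a - 1)\<close>, which is the equality for all \<open>p > 2/3\<close>.
\<close>

section \<open>Nearest-neighbour paths of finite length\<close>

definition extend :: "nat \<Rightarrow> (nat \<Rightarrow> int) \<Rightarrow> int \<Rightarrow> nat \<Rightarrow> int" where
  "extend n s d = (\<lambda>k. if k \<le> n then s k else s n + d)"

text \<open>A path of length \<open>n\<close> is represented by a function that is constant from \<open>n\<close> on.\<close>

fun paths :: "int \<Rightarrow> nat \<Rightarrow> (nat \<Rightarrow> int) set" where
  "paths x 0 = {\<lambda>_. x}"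
| "paths x (Suc n) = (\<lambda>s. extend n s 1) ` paths x n \<union> (\<lambda>s. extend n s (- 1)) ` paths x n"

lemma finite_paths [simp]: "finite (paths x n)"
  by (induction n) auto

lemma extend_le [simp]: "k \<le> n \<Longrightarrow> extend n s d k = s k"
  and extend_Suc [simp]: "extend n s d (Suc n) = s n + d"
  by (auto simp: extend_def)

lemma paths_0: "s \<in> paths x n \<Longrightarrow> s 0 = x"
  by (induction n arbitrary: s) auto

lemma paths_constant: "s \<in> paths x n \<Longrightarrow> n \<le> k \<Longrightarrow> s k = s n"
  by (induction n arbitrary: s k) (auto simp: extend_def)

lemma paths_step: "s \<in> paths x n \<Longrightarrow> k < n \<Longrightarrow> s (Suc k) = s k + 1 \<or> s (Suc k) = s k - 1"
proof (induction n arbitrary: s)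
  case (Suc n)
  then obtain t d where t: "t \<in> paths x n" "s = extend n t d" "d = 1 \<or> d = - 1" by auto
  show ?case
  proof (cases "k < n")
    case True
    with Suc.IH[OF t(1)] t(2) show ?thesis by simp
  next
    case False
    with Suc.prems t(2,3) show ?thesis by (auto simp: less_Suc_eq)
  qed
qed simp

lemma paths_eqI:
  assumes "s \<in> paths x n" "t \<in> paths x n" "\<And>k. k \<le> n \<Longrightarrow> s k = t k"
  shows "s = t"
proof
  fix k
  show "s k = t k"
    using assms paths_constant[of s x n k] paths_constant[of t x n k] by (cases "k \<le> n") auto
qed

lemma sum_paths_Suc:
  "(\<Sum>s\<in>paths x (Suc n). F s) = (\<Sum>s\<in>paths x n. F (extend n s 1) + F (extend n s (- 1)))"
proof -
  have inj: "inj_on (\<lambda>s. extend n s d) (paths x n)" for d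
    by (rule inj_onI, rule paths_eqI) (auto, metis extend_le)
  have disj: "(\<lambda>s. extend n s 1) ` paths x n \<inter> (\<lambda>s. extend n s (- 1)) ` paths x n = {}"
  proof -
    have "extend n s 1 \<noteq> extend n t (- 1)" for s t
    proof
      assume eq: "extend n s 1 = extend n t (- 1)"
      have "s n = t n" using fun_cong[OF eq, of n] by simp
      thus False using fun_cong[OF eq, of "Suc n"] by simp
    qed
    thus ?thesis by blast
  qed
  show ?thesis
    by (simp add: sum.union_disjoint[OF _ _ disj] sum.reindex[OF inj] sum.distrib)
qed

section \<open>Probabilities of finite paths and expectations over them\<close>

context cookie_walk
begin

definition path_prob :: "nat \<Rightarrow> (nat \<Rightarrow> int) \<Rightarrow> real" where
  "path_prob n s = prob {w \<in> space M. \<forall>k\<le>n. X k w = s k}"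

lemma path_prob_nonneg [simp]: "0 \<le> path_prob n s"
  by (simp add: path_prob_def)

lemma right_prob_bounds: "1 / 2 \<le> right_prob \<omega> s n" "right_prob \<omega> s n \<le> 1"
  using environment[of "s n"] by (auto simp: right_prob_def)

text \<open>The walk's transition rule speaks only of trajectories of positive probability. For a
  null trajectory, monotonicity makes the extension null too, so the product rule holds without a
  positivity hypothesis.\<close>

lemma path_prob_Suc:
  assumes d: "d = 1 \<or> d = - 1"
  shows "path_prob (Suc n) (extend n s d) =
    path_prob n s * (if d = 1 then right_prob \<omega> s n else 1 - right_prob \<omega> s n)"
proof -
  have ev: "{w \<in> space M. \<forall>k\<le>Suc n. X k w = extend n s d k} =
      {w \<in> space M. X (Suc n) w = X n w + d \<and> (\<forall>k\<le>n. X k w = s k)}"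
    by (auto simp: le_Suc_eq)
  show ?thesis
  proof (cases "path_prob n s > 0")
    case True
    with step_right[of n s] step_left[of n s] d show ?thesis
      by (auto simp: cond_prob_def path_prob_def ev field_simps)
  next
    case False
    hence 0: "path_prob n s = 0" using path_prob_nonneg[of n s] by linarith
    have "path_prob (Suc n) (extend n s d) \<le> path_prob n s"
      unfolding path_prob_def by (intro finite_measure_mono) (auto simp: le_Suc_eq)
    thus ?thesis using 0 path_prob_nonneg[of "Suc n" "extend n s d"] by simp
  qed
qed

text \<open>The expectation of \<open>F\<close> on the walk frozen at time \<open>n\<close>, as a
  finite sum: neither integrals nor measurability of \<open>F\<close> enter.\<close>

definition path_expectation :: "nat \<Rightarrow> ((nat \<Rightarrow> int) \<Rightarrow> real) \<Rightarrow> real" where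
  "path_expectation n F = (\<Sum>s\<in>paths x n. path_prob n s * F s)"

text \<open>Tower property: the last step is averaged out given the first \<open>n\<close>.
  Martingale identities thereby reduce to pathwise one-step identities.\<close>

lemma path_expectation_Suc:
  "path_expectation (Suc n) F = path_expectation n (\<lambda>s.
     right_prob \<omega> s n * F (extend n s 1) + (1 - right_prob \<omega> s n) * F (extend n s (- 1)))"
  unfolding path_expectation_def sum_paths_Suc
  by (simp add: path_prob_Suc algebra_simps)

lemma path_expectation_mono:
  "(\<And>s. s \<in> paths x n \<Longrightarrow> F s \<le> G s) \<Longrightarrow> path_expectation n F \<le> path_expectation n G"
  unfolding path_expectation_def by (intro sum_mono mult_left_mono) auto

lemma path_expectation_cong:
  "(\<And>s. s \<in> paths x n \<Longrightarrow> F s = G s) \<Longrightarrow> path_expectation n F = path_expectation n G"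
  unfolding path_expectation_def by (intro sum.cong) auto

lemma path_expectation_nonneg:
  "(\<And>s. s \<in> paths x n \<Longrightarrow> 0 \<le> F s) \<Longrightarrow> 0 \<le> path_expectation n F"
  unfolding path_expectation_def by (intro sum_nonneg mult_nonneg_nonneg) auto

lemma path_expectation_add:
  "path_expectation n (\<lambda>s. F s + G s) = path_expectation n F + path_expectation n G"
  by (simp add: path_expectation_def sum.distrib algebra_simps)

lemma path_expectation_diff:
  "path_expectation n (\<lambda>s. F s - G s) = path_expectation n F - path_expectation n G"
  by (simp add: path_expectation_def sum_subtractf algebra_simps)

lemma path_expectation_cmult:
  "path_expectation n (\<lambda>s. c * F s) = c * path_expectation n F"
  by (simp add: path_expectation_def sum_distrib_left algebra_simps)

lemma path_expectation_sums:
  assumes "\<And>s. s \<in> paths x n \<Longrightarrow> (\<lambda>i. F i s) sums G s"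
  shows "(\<lambda>i. path_expectation n (F i)) sums path_expectation n G"
  unfolding path_expectation_def by (intro sums_sum sums_mult assms)

lemma path_prob_0: "path_prob 0 (\<lambda>_. x) = 1"
  using X_0 unfolding path_prob_def by (subst prob_Collect_eq_1) auto

lemma path_expectation_0: "path_expectation 0 F = F (\<lambda>_. x)"
  by (simp add: path_expectation_def path_prob_0)

lemma path_expectation_one: "path_expectation n (\<lambda>_. 1) = 1"
  by (induction n) (simp_all add: path_expectation_0 path_expectation_Suc)

lemma prob_eq_path_expectation:
  assumes Q: "\<And>s t. (\<And>k. k \<le> n \<Longrightarrow> s k = t k) \<Longrightarrow> Q s = Q t"
    and [measurable]: "Measurable.pred M (\<lambda>w. Q (\<lambda>k. X k w))"
  shows "prob {w \<in> space M. Q (\<lambda>k. X k w)} = path_expectation n (\<lambda>s. of_bool (Q s))"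
proof -
  define E where "E s = {w \<in> space M. \<forall>k\<le>n. X k w = s k}" for s
  have [measurable]: "E s \<in> events" for s unfolding E_def by measurable
  have disj: "disjoint_family_on E (paths x n)"
    unfolding disjoint_family_on_def E_def by (auto, metis paths_eqI)
  have union: "prob (\<Union>s\<in>P. E s) = (\<Sum>s\<in>P. path_prob n s)" if "P \<subseteq> paths x n" for P
    using that disj finite_subset[OF that finite_paths]
    by (subst finite_measure_finite_Union)
      (auto simp: path_prob_def E_def[abs_def] intro: disjoint_family_on_mono)
  \<comment> \<open>The path probabilities add up to 1, so almost surely the walk follows one of the
    finitely many paths up to time \<open>n\<close>.\<close>
  have "prob (\<Union>s\<in>paths x n. E s) = 1"
    using path_expectation_one[of n] by (subst union) (auto simp: path_expectation_def)
  hence ae: "AE w in M. w \<in> (\<Union>s\<in>paths x n. E s)"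
    by (subst prob_eq_1[symmetric]) auto
  have "prob {w \<in> space M. Q (\<lambda>k. X k w)} = prob (\<Union>s\<in>{s \<in> paths x n. Q s}. E s)"
  proof (rule finite_measure_eq_AE)
    show "AE w in M. w \<in> {w \<in> space M. Q (\<lambda>k. X k w)} \<longleftrightarrow> w \<in> (\<Union>s\<in>{s \<in> paths x n. Q s}. E s)"
    proof (use ae in eventually_elim)
      case (elim w)
      then obtain s where s: "s \<in> paths x n" "w \<in> E s" by blast
      have "Q t \<longleftrightarrow> Q (\<lambda>k. X k w)" if "w \<in> E t" for t
        using that by (intro Q) (simp add: E_def)
      with s show ?case unfolding E_def by blast
    qed
  qed (auto intro!: sets.finite_UN)
  also have "\<dots> = path_expectation n (\<lambda>s. of_bool (Q s))"
    by (subst union) (auto simp: path_expectation_def of_bool_def sum.If_cases Int_def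
        if_distrib[of "\<lambda>x. _ * x"] cong: if_cong)
  finally show ?thesis .
qed

end

section \<open>Decomposition of hitting by the time of the first hit\<close>

definition first_hit :: "int \<Rightarrow> nat \<Rightarrow> (nat \<Rightarrow> int) \<Rightarrow> bool" where
  "first_hit y n s \<longleftrightarrow> s n = y \<and> (\<forall>k<n. s k \<noteq> y)"

lemma (in cookie_walk) first_hit_sums:
  "(\<lambda>n. path_expectation n (\<lambda>s. of_bool (first_hit y n s))) sums
     (1 - \<P>(w in M. hitting_time X y w = \<infinity>))"
proof -
  define E where "E n = {w \<in> space M. first_hit y n (\<lambda>k. X k w)}" for n
  have [measurable]: "Measurable.pred M (\<lambda>w. first_hit y n (\<lambda>k. X k w))" for n
    unfolding first_hit_def by measurable
  have E: "E n \<in> events" for n unfolding E_def by measurable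
  have "disjoint_family E"
    unfolding disjoint_family_on_def E_def first_hit_def by (auto, metis linorder_neqE_nat)
  with E have "(\<lambda>n. prob (E n)) sums prob (\<Union>n. E n)"
    by (intro finite_measure_UNION) auto
  moreover have "prob (E n) = path_expectation n (\<lambda>s. of_bool (first_hit y n s))" for n
    unfolding E_def by (rule prob_eq_path_expectation) (auto simp: first_hit_def)
  moreover have "{w \<in> space M. hitting_time X y w = \<infinity>} = space M - (\<Union>n. E n)"
  proof -
    have "hitting_time X y w = \<infinity> \<longleftrightarrow> (\<forall>n. X n w \<noteq> y)" for w
      unfolding hitting_time_def by (simp flip: top_enat_def add: INF_top_conv) (simp add: top_enat_def)
    moreover have "(\<exists>n. X n w = y) \<longleftrightarrow> (\<exists>n. first_hit y n (\<lambda>k. X k w))" for w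
      unfolding first_hit_def using exists_least_iff[of "\<lambda>n. X n w = y"] by auto
    ultimately show ?thesis unfolding E_def by blast
  qed
  ultimately show ?thesis using E by (simp add: prob_compl sets.countable_UN)
qed

section \<open>Series of the weights of runs of \<open>n\<close> fresh sites just below a
  level\<close>

definition cookie_coeff :: "real \<Rightarrow> nat \<Rightarrow> real" where
  "cookie_coeff a n = (\<Prod>j=1..n. (real j + 1) / (real j + a))"

lemma cookie_coeff_0 [simp]: "cookie_coeff a 0 = 1"
  by (simp add: cookie_coeff_def)

lemma cookie_coeff_Suc:
  "cookie_coeff a (Suc n) = cookie_coeff a n * ((real n + 2) / (real n + 1 + a))"
  by (simp add: cookie_coeff_def add_ac)

lemma cookie_coeff_nonneg: "0 \<le> a \<Longrightarrow> 0 \<le> cookie_coeff a n"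
  unfolding cookie_coeff_def by (intro prod_nonneg) auto

text \<open>The sequence decreases with increments \<open>(a - 2) * cookie_coeff a n\<close>, so
  these are summable. A positive limit \<open>L\<close> would force \<open>cookie_coeff a n\<close>
  to be at least \<open>L / (n + a)\<close>, against the divergence of the harmonic series.\<close>

lemma cookie_coeff_tendsto_0:
  assumes "a > 2"
  shows "(\<lambda>n. (real n + a) * cookie_coeff a n) \<longlonglongrightarrow> 0"
proof -
  let ?t = "\<lambda>n. (real n + a) * cookie_coeff a n"
  have diff: "?t n - ?t (Suc n) = (a - 2) * cookie_coeff a n" for n
    using assms by (simp add: cookie_coeff_Suc field_simps)
  have nonneg: "0 \<le> cookie_coeff a n" for n using assms by (simp add: cookie_coeff_nonneg)
  have "decseq ?t"
  proof (rule decseq_SucI)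
    fix n
    have "0 \<le> (a - 2) * cookie_coeff a n" using assms nonneg by simp
    thus "?t (Suc n) \<le> ?t n" using diff[of n] by linarith
  qed
  then obtain L where L: "?t \<longlonglongrightarrow> L" and le: "\<And>n. L \<le> ?t n"
    using decseq_convergent[of ?t 0] nonneg assms by (smt (verit) mult_nonneg_nonneg of_nat_0_le_iff)
  have "0 \<le> L"
    by (rule LIMSEQ_le_const[OF L]) (use nonneg assms in \<open>auto intro!: exI[of _ 0]\<close>)
  moreover have "\<not> 0 < L"
  proof
    assume pos: "0 < L"
    \<comment> \<open>An integer above \<open>a\<close> turns the lower bound into a shifted
      harmonic series.\<close>
    obtain A :: nat where A: "a \<le> real A" using real_arch_simple by blast
    have "summable (\<lambda>n. (a - 2) * cookie_coeff a n)"
      using telescope_sums'[OF L] unfolding diff sums_iff by simp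
    hence s: "summable (\<lambda>n. cookie_coeff a n)" using assms by (simp add: summable_cmult_iff)
    have "summable (\<lambda>n. inverse (real (n + A)))"
    proof (rule summable_comparison_test')
      show "summable (\<lambda>n. cookie_coeff a n / L)" by (rule summable_divide[OF s])
      fix n :: nat
      have "inverse (real (n + A)) \<le> inverse (real n + a)"
        using A assms by (intro le_imp_inverse_le) auto
      also have "\<dots> \<le> cookie_coeff a n / L"
        using le[of n] pos assms by (simp add: field_simps)
      finally show "norm (inverse (real (n + A))) \<le> cookie_coeff a n / L" by simp
    qed
    hence "summable (\<lambda>n. inverse (real n))" by (subst (asm) summable_iff_shift)
    thus False using not_summable_harmonic[where 'a = real] by simp
  qed
  ultimately show ?thesis using L by simp
qed

text \<open>The series telescopes, from the value \<open>a\<close> of \<open>?t\<close> at 0 down to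
  the limit 0.\<close>

lemma cookie_coeff_sums:
  assumes "a > 2"
  shows "cookie_coeff a sums (a / (a - 2))"
proof -
  let ?t = "\<lambda>n. (real n + a) * cookie_coeff a n"
  have diff: "?t n - ?t (Suc n) = (a - 2) * cookie_coeff a n" for n
    using assms by (simp add: cookie_coeff_Suc field_simps)
  have "(\<lambda>n. (a - 2) * cookie_coeff a n) sums a"
    using telescope_sums'[OF cookie_coeff_tendsto_0[OF assms]] unfolding diff by simp
  from sums_divide[OF this, of "a - 2"] show ?thesis using assms by simp
qed

text \<open>Dividing the previous telescoping sequence by \<open>n + 1\<close> gives one whose
  increments carry the factor \<open>a - 1\<close> in place of \<open>a - 2\<close>; it also starts
  at \<open>a\<close>.\<close>

lemma cookie_coeff_divide_sums:
  assumes "a > 2"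
  shows "(\<lambda>n. cookie_coeff a n / (real n + 1)) sums (a / (a - 1))"
proof -
  let ?t = "\<lambda>n. (real n + a) * cookie_coeff a n / (real n + 1)"
  have diff: "?t n - ?t (Suc n) = (a - 1) * (cookie_coeff a n / (real n + 1))" for n
    using assms by (simp add: cookie_coeff_Suc divide_simps) (simp add: algebra_simps)
  have "?t \<longlonglongrightarrow> 0"
    using tendsto_mult[OF cookie_coeff_tendsto_0[OF assms] LIMSEQ_inverse_real_of_nat]
    by (simp add: divide_inverse add_ac)
  from telescope_sums'[OF this] have "(\<lambda>n. (a - 1) * (cookie_coeff a n / (real n + 1))) sums a"
    unfolding diff by simp
  from sums_divide[OF this, of "a - 1"] show ?thesis using assms by simp
qed

text \<open>Tonelli for double series: the swap is unconditional in the extended nonnegative reals,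
  and finiteness of \<open>r\<close> returns real summability.\<close>

lemma sums_swap_nonneg:
  fixes f :: "nat \<Rightarrow> nat \<Rightarrow> real"
  assumes nonneg: "\<And>i k. 0 \<le> f i k"
    and rows: "\<And>i. f i sums R i" and r: "R sums r"
    and columns: "\<And>k. (\<lambda>i. f i k) sums C k"
  shows "C sums r"
proof -
  have R: "0 \<le> R i" for i by (rule sums_le[OF nonneg sums_zero rows])
  have C: "0 \<le> C k" for k by (rule sums_le[OF nonneg sums_zero columns])
  have r0: "0 \<le> r" by (rule sums_le[OF R sums_zero r])
  have "(\<Sum>k. ennreal (C k)) = (\<Sum>k. \<Sum>i. ennreal (f i k))"
    by (intro suminf_cong suminf_ennreal_eq[symmetric] nonneg columns)
  also have "\<dots> = (\<Sum>i. \<Sum>k. ennreal (f i k))"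
    \<comment> \<open>The outer series is read as an integral against counting measure.\<close>
    using nn_integral_suminf[of "\<lambda>i k. ennreal (f i k)" "count_space UNIV"]
    by (simp add: nn_integral_count_space_nat)
  also have "\<dots> = (\<Sum>i. ennreal (R i))"
    by (intro suminf_cong suminf_ennreal_eq nonneg rows)
  also have "\<dots> = ennreal r"
    by (intro suminf_ennreal_eq R r)
  finally have eq: "(\<Sum>k. ennreal (C k)) = ennreal r" .
  have "summable C" by (rule summable_suminf_not_top) (use C eq in auto)
  moreover from this have "suminf C = r"
    using eq C r0 by (simp add: suminf_ennreal2 suminf_nonneg)
  ultimately show ?thesis by (simp add: sums_iff)
qed

section \<open>Remaining cookies and the martingale built from them\<close>

definition fresh :: "nat \<Rightarrow> (nat \<Rightarrow> int) \<Rightarrow> int set" where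
  "fresh n s = {y. \<not> (\<exists>k<n. s k = y \<and> s (Suc k) = y - 1)}"

lemma jumped_left_before_iff_fresh: "jumped_left_before s n \<longleftrightarrow> s n \<notin> fresh n s"
  by (auto simp: jumped_left_before_def fresh_def)

lemma fresh_0 [simp]: "fresh 0 s = UNIV"
  by (simp add: fresh_def)

lemma fresh_Suc: "fresh (Suc n) s = fresh n s - (if s (Suc n) = s n - 1 then {s n} else {})"
  by (auto simp: fresh_def less_Suc_eq)

lemma fresh_extend: "fresh n (extend n s d) = fresh n s"
  by (simp add: fresh_def cong: conj_cong)

lemma fresh_extend_right: "fresh (Suc n) (extend n s 1) = fresh n s"
  by (simp add: fresh_Suc fresh_extend)

lemma fresh_extend_left: "fresh (Suc n) (extend n s (- 1)) = fresh n s - {s n}"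
  by (simp add: fresh_Suc fresh_extend)

text \<open>With unit steps, passing from \<open>y\<close> or above to below \<open>y\<close>
  requires a step from \<open>y\<close> to \<open>y - 1\<close>, which eats the cookie at
  \<open>y\<close>. The induction runs backwards in time from \<open>n\<close> to
  \<open>j\<close>.\<close>

lemma crossed_down_not_fresh:
  assumes s: "s \<in> paths x n" and "y \<le> s j" "j \<le> n" "s n < y"
  shows "y \<notin> fresh n s"
  using \<open>j \<le> n\<close> \<open>y \<le> s j\<close>
proof (induction rule: inc_induct)
  case base
  with \<open>s n < y\<close> show ?case by simp
next
  case (step i)
  show ?case
  proof (cases "y \<le> s (Suc i)")
    case True
    with step.IH show ?thesis .
  next
    case False
    with paths_step[OF s, of i] step show ?thesis by (auto simp: fresh_def)
  qed
qed

text \<open>With D = N - y, this is the solution w of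
  \<open>p * (D - 1) * w + (1 - p) * (D + 1) = D * w\<close> for \<open>a = p / (1 - p)\<close>: a
  right step keeps the factor w, a left step removes it, and the mean is preserved.\<close>

definition cookie_weight :: "real \<Rightarrow> int \<Rightarrow> int \<Rightarrow> real" where
  "cookie_weight a N y = (of_int (N - y) + 1) / (of_int (N - y) + a)"

text \<open>The linear factor alone is a martingale for the symmetric walk; the weights compensate
  the drift at fresh sites. It vanishes when the walk is at \<open>N\<close>.\<close>

definition cookie_martingale :: "real \<Rightarrow> int \<Rightarrow> nat \<Rightarrow> (nat \<Rightarrow> int) \<Rightarrow> real" where
  "cookie_martingale a N n s =
     of_int (N - s n) / of_int N * (\<Prod>y\<in>{1..<N} \<inter> fresh n s. cookie_weight a N y)"

text \<open>Sites are reindexed by their distance to \<open>N\<close>, which runs from 1 to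
  \<open>N - m - 1\<close>.\<close>

lemma prod_cookie_weight:
  assumes "m < N"
  shows "(\<Prod>y\<in>{m<..<N}. cookie_weight a N y) = cookie_coeff a (nat (N - m - 1))"
  unfolding cookie_coeff_def
  by (rule prod.reindex_bij_witness[of _ "\<lambda>j. N - int j" "\<lambda>y. nat (N - y)"])
    (auto simp: cookie_weight_def)

lemma cookie_weight_bounds:
  assumes "1 \<le> a" "y < N"
  shows "0 \<le> cookie_weight a N y" "cookie_weight a N y \<le> 1"
  using assms by (auto simp: cookie_weight_def)

lemma cookie_martingale_bounds:
  assumes "1 \<le> a" "0 \<le> s n" "s n \<le> N"
  shows "0 \<le> cookie_martingale a N n s" "cookie_martingale a N n s \<le> 1"
proof -
  have "0 \<le> (\<Prod>y\<in>{1..<N} \<inter> fresh n s. cookie_weight a N y)"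
    using assms by (intro prod_nonneg) (auto simp: cookie_weight_bounds)
  moreover have "(\<Prod>y\<in>{1..<N} \<inter> fresh n s. cookie_weight a N y) \<le> 1"
    using assms by (intro prod_le_1) (auto simp: cookie_weight_bounds)
  moreover have "0 \<le> real_of_int (N - s n) / of_int N" "real_of_int (N - s n) / of_int N \<le> 1"
    using assms by (auto simp: divide_le_eq)
  ultimately show "0 \<le> cookie_martingale a N n s" "cookie_martingale a N n s \<le> 1"
    unfolding cookie_martingale_def by (blast intro: mult_nonneg_nonneg mult_le_one)+
qed

section \<open>One-step balance and exit from the interval\<close>

definition stays_inside :: "int \<Rightarrow> nat \<Rightarrow> (nat \<Rightarrow> int) \<Rightarrow> bool" where
  "stays_inside N n s \<longleftrightarrow> (\<forall>k\<le>n. 0 < s k \<and> s k < N)"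

definition exits_at_0 :: "int \<Rightarrow> nat \<Rightarrow> (nat \<Rightarrow> int) \<Rightarrow> bool" where
  "exits_at_0 N n s \<longleftrightarrow> s n = 0 \<and> (\<forall>k<n. 0 < s k \<and> s k < N)"

lemma stays_inside_extend:
  "stays_inside N (Suc n) (extend n s d) \<longleftrightarrow> stays_inside N n s \<and> 0 < s n + d \<and> s n + d < N"
  by (auto simp: stays_inside_def le_Suc_eq)

lemma exits_at_0_extend:
  "exits_at_0 N (Suc n) (extend n s d) \<longleftrightarrow> stays_inside N n s \<and> s n + d = 0"
  by (auto simp: stays_inside_def exits_at_0_def less_Suc_eq_le)

text \<open>From inside, one step stays inside, exits at 0, or exits at \<open>N\<close>; the last
  case contributes nothing because the martingale is zero there.\<close>

lemma stopped_cookie_martingale_extend: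
  assumes "d = 1 \<or> d = - 1"
  shows "of_bool (stays_inside N (Suc n) (extend n s d)) * cookie_martingale a N (Suc n) (extend n s d)
      + of_bool (exits_at_0 N (Suc n) (extend n s d)) * cookie_martingale a N (Suc n) (extend n s d)
      = of_bool (stays_inside N n s) * cookie_martingale a N (Suc n) (extend n s d)"
proof (cases "stays_inside N n s")
  case True
  hence "0 < s n" "s n < N" by (auto simp: stays_inside_def)
  with assms consider "0 < s n + d \<and> s n + d < N" | "s n + d = 0" | "s n + d = N" by fastforce
  thus ?thesis
    by cases (use True in \<open>auto simp: stays_inside_extend exits_at_0_extend cookie_martingale_def\<close>)
qed (simp add: stays_inside_extend exits_at_0_extend)

lemma right_prob_const:
  "right_prob (\<lambda>_. p) s n = (if s n \<in> fresh n s then p else 1 / 2)"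
  by (simp add: right_prob_def jumped_left_before_iff_fresh)

lemma cookie_martingale_step:
  fixes p :: real
  assumes "1 / 2 \<le> p" "p < 1" and a: "a = p / (1 - p)" and "stays_inside N n s"
  shows "right_prob (\<lambda>_. p) s n * cookie_martingale a N (Suc n) (extend n s 1) +
    (1 - right_prob (\<lambda>_. p) s n) * cookie_martingale a N (Suc n) (extend n s (- 1)) =
    cookie_martingale a N n s"
proof -
  define D where "D = real_of_int (N - s n)"
  have N: "0 < s n" "s n < N" using assms by (auto simp: stays_inside_def)
  hence D: "0 < D" by (simp add: D_def)
  have D': "real_of_int (N - s n) = D" "real_of_int (N - extend n s 1 (Suc n)) = D - 1"
      "real_of_int (N - extend n s (- 1) (Suc n)) = D + 1"
    by (auto simp: D_def)
  show ?thesis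
  proof (cases "s n \<in> fresh n s")
    case True
    define P where "P = (\<Prod>y\<in>{1..<N} \<inter> fresh n s - {s n}. cookie_weight a N y)"
    have P: "(\<Prod>y\<in>{1..<N} \<inter> fresh n s. cookie_weight a N y) = cookie_weight a N (s n) * P"
      unfolding P_def using N True by (intro prod.remove) auto
    have P': "(\<Prod>y\<in>{1..<N} \<inter> (fresh n s - {s n}). cookie_weight a N y) = P"
      by (simp add: P_def Int_Diff)
    have w: "cookie_weight a N (s n) = (D + 1) / (D + a)"
      by (simp add: cookie_weight_def D_def)
    have "(1 - p) * a = p" using assms by simp
    moreover have "D + a \<noteq> 0" using D assms by (auto simp: add_pos_nonneg less_imp_neq[symmetric])
    hence "(D + a) * cookie_weight a N (s n) = D + 1" by (simp add: w)
    \<comment> \<open>This is the equation that determines the weight of a fresh site.\<close>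
    ultimately have "(1 - p) * (D + 1) = ((1 - p) * D + p) * cookie_weight a N (s n)"
      by (metis distrib_left mult.assoc)
    hence "p * (D - 1) * cookie_weight a N (s n) + (1 - p) * (D + 1)
        = D * cookie_weight a N (s n)"
      by (simp add: algebra_simps)
    hence "(p * (D - 1) * cookie_weight a N (s n) + (1 - p) * (D + 1)) * P / of_int N
        = D * cookie_weight a N (s n) * P / of_int N"
      by simp
    thus ?thesis
      unfolding cookie_martingale_def fresh_extend_right fresh_extend_left P P' right_prob_const D'
      using True by (simp add: algebra_simps add_divide_distrib diff_divide_distrib)
  next
    case False
    \<comment> \<open>Without a cookie both steps have probability 1/2 and leave the product
      unchanged, so linearity in the position suffices.\<close>
    hence "fresh n s - {s n} = fresh n s" by simp
    with False N show ?thesis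
      unfolding cookie_martingale_def fresh_extend_right fresh_extend_left right_prob_const D'
      by (simp add: field_simps)
  qed
qed

text \<open>The sum over the levels \<open>N\<close> does not depend on the path: when a path first hits \<open>0\<close>, exactly the
  sites above its maximum are fresh.\<close>

lemma cookie_martingale_exit_sums:
  assumes "2 < a" and s: "s \<in> paths 1 n"
  shows "(\<lambda>i. of_bool (exits_at_0 (int (Suc i)) n s) * cookie_martingale a (int (Suc i)) n s) sums
    (a / (a - 2) * of_bool (first_hit 0 n s))"
proof (cases "first_hit 0 n s")
  case False
  hence "\<not> exits_at_0 N n s" for N by (auto simp: exits_at_0_def first_hit_def)
  with False show ?thesis by simp
next
  case True
  hence n: "s n = 0" "n \<noteq> 0" and nz: "\<And>k. k < n \<Longrightarrow> s k \<noteq> 0"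
    using paths_0[OF s] by (auto simp: first_hit_def intro: gr0I)
  have pos: "0 < s k" if "k < n" for k
    using that
  proof (induction k)
    case (Suc k)
    with nz[of "Suc k"] paths_step[OF s, of k] show ?case by auto
  qed (simp add: paths_0[OF s])
  define m where "m = Max (s ` {..<n})"
  have le_m: "s k \<le> m" if "k < n" for k
    unfolding m_def using that by (intro Max_ge) auto
  have "m \<in> s ` {..<n}" unfolding m_def using n by (intro Max_in) auto
  then obtain j where j: "j < n" "s j = m" by auto
  have m: "0 < m" using pos[OF j(1)] j by simp
  have eq: "of_bool (exits_at_0 N n s) * cookie_martingale a N n s =
      (if m < N then cookie_coeff a (nat (N - m - 1)) else 0)" if "0 < N" for N
  proof (cases "m < N")
    case mN: True
    have fresh: "y \<in> fresh n s \<longleftrightarrow> m < y" if "0 < y" for y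
    proof
      assume "m < y"
      thus "y \<in> fresh n s" using le_m by (force simp: fresh_def)
    next
      assume "y \<in> fresh n s"
      \<comment> \<open>A site \<open>y\<close> with \<open>0 < y\<close> and
        \<open>y \<le> m\<close> lies at or below the maximum, attained at time \<open>j\<close>,
        and above the endpoint 0, so it was crossed downwards.\<close>
      with crossed_down_not_fresh[OF s, of y j] j n that show "m < y" by force
    qed
    have "{1..<N} \<inter> fresh n s = {m<..<N}"
      using fresh m by auto
    hence "cookie_martingale a N n s = cookie_coeff a (nat (N - m - 1))"
      using mN n that by (simp add: cookie_martingale_def prod_cookie_weight)
    moreover have "exits_at_0 N n s"
      using n pos le_m mN by (force simp: exits_at_0_def)
    ultimately show ?thesis using mN by simp
  next
    case False
    hence "\<not> exits_at_0 N n s" using j by (auto simp: exits_at_0_def)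
    with False show ?thesis by simp
  qed
  let ?f = "\<lambda>i. of_bool (exits_at_0 (int (Suc i)) n s) * cookie_martingale a (int (Suc i)) n s"
  have f: "?f i = (if m < int (Suc i) then cookie_coeff a (nat (int (Suc i) - m - 1)) else 0)" for i
    by (rule eq) simp
  \<comment> \<open>Index \<open>i\<close> stands for level \<open>i + 1\<close>, so the first
    \<open>m\<close> levels are too low to allow the exit at 0, and level \<open>i + m + 1\<close>
    leaves exactly \<open>i\<close> fresh sites above \<open>m\<close>.\<close>
  have "(\<lambda>i. ?f (i + nat m)) = cookie_coeff a"
    unfolding f using m by auto
  hence "(\<lambda>i. ?f (i + nat m)) sums (a / (a - 2))"
    using cookie_coeff_sums[OF assms(1)] by simp
  moreover have "(\<Sum>i<nat m. ?f i) = 0"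
    unfolding f by (intro sum.neutral) auto
  ultimately have "?f sums (a / (a - 2))"
    using sums_iff_shift[of ?f "nat m"] by simp
  with True show ?thesis by simp
qed

section \<open>Optional stopping at each level and summation over the levels\<close>

context
  fixes M :: "'a measure" and X :: "nat \<Rightarrow> 'a \<Rightarrow> int" and p a :: real
  assumes walk: "cookie_walk M (\<lambda>_. p) 1 X"
    and p: "2 / 3 < p" and a: "a = p / (1 - p)"
begin

interpretation cookie_walk M "\<lambda>_. p" 1 X by (rule walk)

lemma cookie_parameter: "p < 1" "2 < a"
  using environment p unfolding a by (auto simp: field_simps)

text \<open>While the walk stays inside \<open>{0<..<N}\<close>, the mean of \<open>N\<^sup>2 - (X n)\<^sup>2\<close> drops by at least \<open>1\<close> per step.\<close>

lemma prob_inside_tendsto_0: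
  "(\<lambda>n. path_expectation n (\<lambda>s. of_bool (stays_inside N n s))) \<longlonglongrightarrow> 0"
proof -
  define g where "g y = real_of_int (N\<^sup>2 - y\<^sup>2)" for y
  define G where "G n = path_expectation n (\<lambda>s. of_bool (stays_inside N n s) * g (s n))" for n
  let ?I = "\<lambda>n. path_expectation n (\<lambda>s. of_bool (stays_inside N n s))"
  have g: "0 \<le> g y" if "0 \<le> y" "y \<le> N" for y
    using that by (simp add: g_def power_mono)
  have step: "G (Suc n) \<le> G n - ?I n" for n
    unfolding G_def path_expectation_Suc path_expectation_diff[symmetric]
  proof (rule path_expectation_mono)
    fix s
    let ?r = "right_prob (\<lambda>_. p) s n"
    let ?h = "\<lambda>d. of_bool (stays_inside N (Suc n) (extend n s d)) * g (extend n s d (Suc n))"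
    show "?r * ?h 1 + (1 - ?r) * ?h (- 1) \<le>
      of_bool (stays_inside N n s) * g (s n) - of_bool (stays_inside N n s)"
    proof (cases "stays_inside N n s")
      case True
      hence sn: "0 < s n" "s n < N" by (auto simp: stays_inside_def)
      have h: "?h d \<le> g (s n + d)" if "d = 1 \<or> d = - 1" for d
        using g[of "s n + d"] sn that by auto
      have "?r * ?h 1 + (1 - ?r) * ?h (- 1) \<le> ?r * g (s n + 1) + (1 - ?r) * g (s n - 1)"
        using h[of 1] h[of "- 1"] right_prob_bounds[of s n]
        by (intro add_mono mult_left_mono) auto
      also have "\<dots> = g (s n) - 1 - 2 * (2 * ?r - 1) * of_int (s n)"
        by (simp add: g_def power2_eq_square algebra_simps)
      \<comment> \<open>The drift is never to the left and the position is positive, so the drift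
        term only lowers the mean.\<close>
      also have "\<dots> \<le> g (s n) - 1"
        using right_prob_bounds[of s n] sn by simp
      finally show ?thesis using True by simp
    qed (simp add: stays_inside_extend)
  qed
  have sum: "(\<Sum>k<n. ?I k) \<le> G 0 - G n" for n
  proof (induction n)
    case (Suc n)
    thus ?case using step[of n] by simp
  qed simp
  have nonneg: "0 \<le> G n" for n
    unfolding G_def using g by (intro path_expectation_nonneg) (auto simp: stays_inside_def)
  have "summable ?I"
  proof (rule summableI_nonneg_bounded[where x = "G 0"])
    fix n
    show "(\<Sum>k<n. ?I k) \<le> G 0" using sum[of n] nonneg[of n] by linarith
  qed (intro path_expectation_nonneg, simp)
  thus ?thesis by (rule summable_LIMSEQ_zero)
qed

text \<open>The part of the optional stopping identity due to exits at 0 at time \<open>n\<close>.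
  The level is \<open>Suc i\<close>, so that \<open>i\<close> ranges over all naturals and the level
  stays positive.\<close>

definition exit_mass :: "nat \<Rightarrow> nat \<Rightarrow> real" where
  "exit_mass i n = path_expectation n
     (\<lambda>s. of_bool (exits_at_0 (int (Suc i)) n s) * cookie_martingale a (int (Suc i)) n s)"

text \<open>Optional stopping as a telescoping sum: what \<open>A\<close> loses in each step is
  exactly the mass exiting at 0, and \<open>A\<close> tends to 0. The total is therefore the initial
  value; for \<open>i = 0\<close> the walk starts on the level itself and both sides are 0.\<close>

lemma exit_mass_sums: "exit_mass i sums (real i / (real i + 1) * cookie_coeff a i)"
proof -
  define N where "N = int (Suc i)"
  define A where "A n = path_expectation n (\<lambda>s. of_bool (stays_inside N n s) * cookie_martingale a N n s)" for n
  have B: "exit_mass i n = path_expectation n (\<lambda>s. of_bool (exits_at_0 N n s) * cookie_martingale a N n s)" for n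
    by (simp add: exit_mass_def N_def)
  have A0: "A 0 = real i / (real i + 1) * cookie_coeff a i"
  proof -
    have "{1..<N} = {0<..<N}" by auto
    thus ?thesis
      using prod_cookie_weight[of 0 N a]
      by (simp add: A_def path_expectation_0 cookie_martingale_def stays_inside_def)
        (auto simp: N_def)
  qed
  have step: "A (Suc n) + exit_mass i (Suc n) = A n" for n
    unfolding A_def B path_expectation_add[symmetric]
    unfolding path_expectation_Suc
  proof (rule path_expectation_cong)
    fix s
    let ?r = "right_prob (\<lambda>_. p) s n"
    let ?W = "\<lambda>d. cookie_martingale a N (Suc n) (extend n s d)"
    have "?r * (of_bool (stays_inside N n s) * ?W 1) + (1 - ?r) * (of_bool (stays_inside N n s) * ?W (- 1))
        = of_bool (stays_inside N n s) * (?r * ?W 1 + (1 - ?r) * ?W (- 1))"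
      by (simp add: algebra_simps)
    also have "\<dots> = of_bool (stays_inside N n s) * cookie_martingale a N n s"
      using cookie_martingale_step[of p a N n s] p cookie_parameter a by (cases "stays_inside N n s") auto
    finally show "?r * (of_bool (stays_inside N (Suc n) (extend n s 1)) * ?W 1
          + of_bool (exits_at_0 N (Suc n) (extend n s 1)) * ?W 1)
        + (1 - ?r) * (of_bool (stays_inside N (Suc n) (extend n s (- 1))) * ?W (- 1)
          + of_bool (exits_at_0 N (Suc n) (extend n s (- 1))) * ?W (- 1))
        = of_bool (stays_inside N n s) * cookie_martingale a N n s"
      by (simp only: stopped_cookie_martingale_extend[OF disjI1[OF refl]]
          stopped_cookie_martingale_extend[OF disjI2[OF refl]])
  qed
  \<comment> \<open>The martingale lies between 0 and 1 inside the interval, so \<open>A\<close> is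
    dominated by the vanishing probability of still being inside.\<close>
  have "A \<longlonglongrightarrow> 0"
  proof (rule tendsto_sandwich[OF _ _ tendsto_const prob_inside_tendsto_0[of N]])
    show "\<forall>\<^sub>F n in sequentially. 0 \<le> A n"
      unfolding A_def using cookie_parameter
      by (intro always_eventually allI path_expectation_nonneg)
        (auto simp: stays_inside_def intro!: cookie_martingale_bounds)
    show "\<forall>\<^sub>F n in sequentially. A n \<le> path_expectation n (\<lambda>s. of_bool (stays_inside N n s))"
      unfolding A_def using cookie_parameter
      by (intro always_eventually allI path_expectation_mono)
        (auto simp: stays_inside_def intro!: cookie_martingale_bounds)
  qed
  from telescope_sums'[OF this] have "(\<lambda>n. A n - A (Suc n)) sums A 0" by simp
  moreover have "A n - A (Suc n) = exit_mass i (Suc n)" for n using step[of n] by simp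
  moreover have "exit_mass i 0 = 0"
    by (simp add: B path_expectation_0 exits_at_0_def)
  ultimately show ?thesis using sums_Suc_iff[of "exit_mass i"] A0 by simp
qed

lemma escape_probability:
  "\<P>(w in M. hitting_time X 0 w = \<infinity>) = (3 * p - 2) / (2 * p - 1)"
proof -
  let ?q = "\<P>(w in M. hitting_time X 0 w = \<infinity>)"
  let ?S = "a / (a - 2)"
  \<comment> \<open>Rows are levels and columns are times: row sums come from optional stopping,
    column sums from the path-independent sum over levels.\<close>
  have "(\<lambda>n. ?S * path_expectation n (\<lambda>s. of_bool (first_hit 0 n s))) sums (?S - a / (a - 1))"
  proof (rule sums_swap_nonneg)
    show "0 \<le> exit_mass i n" for i n
      unfolding exit_mass_def using cookie_parameter
      by (intro path_expectation_nonneg)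
        (auto simp: exits_at_0_def intro!: cookie_martingale_bounds)
    show "exit_mass i sums (real i / (real i + 1) * cookie_coeff a i)" for i
      by (rule exit_mass_sums)
    have "real i / (real i + 1) * cookie_coeff a i = cookie_coeff a i - cookie_coeff a i / (real i + 1)" for i
      by (simp add: field_simps)
    thus "(\<lambda>i. real i / (real i + 1) * cookie_coeff a i) sums (?S - a / (a - 1))"
      using sums_diff[OF cookie_coeff_sums cookie_coeff_divide_sums] cookie_parameter by simp
    show "(\<lambda>i. exit_mass i n) sums (?S * path_expectation n (\<lambda>s. of_bool (first_hit 0 n s)))" for n
      unfolding exit_mass_def path_expectation_cmult[symmetric]
      using cookie_parameter by (intro path_expectation_sums cookie_martingale_exit_sums) auto
  qed
  moreover have "(\<lambda>n. ?S * path_expectation n (\<lambda>s. of_bool (first_hit 0 n s))) sums (?S * (1 - ?q))"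
    by (intro sums_mult first_hit_sums)
  \<comment> \<open>The same series is evaluated a second time by decomposing the event of hitting 0
    by its first hitting time.\<close>
  ultimately have "?S - a / (a - 1) = ?S * (1 - ?q)" by (rule sums_unique2)
  hence "?S * ?q = a / (a - 1)" by (simp add: algebra_simps)
  hence "a * ((a - 1) * ?q) = a * (a - 2)" using cookie_parameter by (simp add: field_simps)
  moreover have "a \<noteq> 0" using cookie_parameter by simp
  ultimately have "(a - 1) * ?q = a - 2" by (metis mult_left_cancel)
  hence "?q = (a - 2) / (a - 1)" using cookie_parameter by (simp add: field_simps)
  also have "\<dots> = (3 * p - 2) / (2 * p - 1)"
    using p cookie_parameter by (simp add: a divide_simps)
  finally show ?thesis .
qed

end

theorem proposition2:
  fixes M :: "'a measure" and X :: "nat \<Rightarrow> 'a \<Rightarrow> int" and p :: real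
  assumes "cookie_walk M (\<lambda>_. p) 1 X"
  shows "(p \<in> {2/3<..<3/4} \<longrightarrow>
            \<P>(w in M. hitting_time X 0 w = \<infinity>) \<ge> (3 * p - 2) / (2 * p - 1)) \<and>
         (p \<in> {3/4..<1} \<longrightarrow>
            \<P>(w in M. hitting_time X 0 w = \<infinity>) = (3 * p - 2) / (2 * p - 1))"
  using escape_probability[OF assms] by auto

end
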